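(* Let $N$ be a positive integer and let $\mathbf{w}\in\mathcal{W}=\{\mathbf{w}\in\mathbb{R}^N\mid \sum_{i=1}^N w_i=0,\ w_1\le\dots\le w_N,\ w_1<0,\ w_N>0\}$. Then the order-based fairness measure $\nu_{\mathbf{w}}:\mathbb{R}^N\to\mathbb{R}$ defined by $\nu_{\mathbf{w}}(\mathbf{u})=\sum_{i=1}^N w_i u_{(i)}$ satisfies all of the following axioms: Continuity, Normalization, Symmetry, Schur Convexity, Translation Invariance, and Positive Homogeneity.
   Context: For $\mathbf{u}\in\mathbb{R}^N$, $u_{(i)}$ denotes the $i$th smallest entry of $\mathbf{u}$ (counted with multiplicity), and $\mathbf{1}$ is the all-ones vector. For $\mathbf{x},\mathbf{y}\in\mathbb{R}^N$, $\mathbf{x}\preceq\mathbf{y}$ ($\mathbf{x}$ is majorized by $\mathbf{y}$) means $\sum_{i=1}^N x_i=\sum_{i=1}^N y_i$ and $\sum_{i=k}^N x_{(i)}\le\sum_{i=k}^N y_{(i)}$ for all $k\in\{2,\dots,N\}$. Axioms for a function $\phi:\mathbb{R}^N\to\mathbb{R}$: - Continuity: $\phi$ is continuous on $\mathbb{R}^N$. - Normalization: $\phi(\mathbf{u})\ge0$ for all $\mathbf{u}\in\mathbb{R}^N$, and $\phi(\mathbf{u})=0$ if and only if $\mathbf{u}=\alpha\mathbf{1}$ for some $\alpha\in\mathbb{R}$. - Symmetry: $\phi(P\mathbf{u})=\phi(\mathbf{u})$ for all $\mathbf{u}\in\mathbb{R}^N$ and all permutation matrices $P$. - Schur Convexity: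 if $\mathbf{u}^1\preceq\mathbf{u}^2$ then $\phi(\mathbf{u}^1)\le\phi(\mathbf{u}^2)$. - Translation Invariance: $\phi(\mathbf{u}+\alpha\mathbf{1})=\phi(\mathbf{u})$ for all $\mathbf{u}\in\mathbb{R}^N$, $\alpha\in\mathbb{R}$. - Positive Homogeneity: $\phi(\alpha\mathbf{u})=\alpha\phi(\mathbf{u})$ for all $\mathbf{u}\in\mathbb{R}^N$, $\alpha>0$. *)

theory Defs
  imports "HOL-Analysis.Analysis"
begin

(* Indices of order statistics and of weights run from 1 to N = CARD('n). *)

definition order_stat :: "real ^ 'n \<Rightarrow> nat \<Rightarrow> real" where
  "order_stat u i =
     sorted_list_of_multiset (image_mset (\<lambda>j. u $ j) (mset_set UNIV)) ! (i - 1)"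

definition majorized_by :: "real ^ 'n \<Rightarrow> real ^ 'n \<Rightarrow> bool" (infix "\<preceq>" 50) where
  "x \<preceq> y \<longleftrightarrow>
     (\<Sum>i\<in>UNIV. x $ i) = (\<Sum>i\<in>UNIV. y $ i) \<and>
     (\<forall>k\<in>{2..CARD('n)}.
        (\<Sum>i=k..CARD('n). order_stat x i) \<le> (\<Sum>i=k..CARD('n). order_stat y i))"

definition permutation_matrix :: "real ^ 'n ^ 'n \<Rightarrow> bool" where
  "permutation_matrix P \<longleftrightarrow>
     (\<forall>i j. P $ i $ j \<in> {0, 1}) \<and>
     (\<forall>i. \<exists>!j. P $ i $ j = 1) \<and>
     (\<forall>j. \<exists>!i. P $ i $ j = 1)"

definition continuity_axiom :: "(real ^ 'n \<Rightarrow> real) \<Rightarrow> bool" where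
  "continuity_axiom \<phi> \<longleftrightarrow> continuous_on UNIV \<phi>"

(* In the following, 1 :: real ^ 'n is the all-ones vector. *)

definition normalization_axiom :: "(real ^ 'n \<Rightarrow> real) \<Rightarrow> bool" where
  "normalization_axiom \<phi> \<longleftrightarrow>
     (\<forall>u. \<phi> u \<ge> 0) \<and> (\<forall>u. \<phi> u = 0 \<longleftrightarrow> (\<exists>\<alpha>. u = \<alpha> *\<^sub>R 1))"

definition symmetry_axiom :: "(real ^ 'n \<Rightarrow> real) \<Rightarrow> bool" where
  "symmetry_axiom \<phi> \<longleftrightarrow> (\<forall>u P. permutation_matrix P \<longrightarrow> \<phi> (P *v u) = \<phi> u)"

definition schur_convexity_axiom :: "(real ^ 'n \<Rightarrow> real) \<Rightarrow> bool" where
  "schur_convexity_axiom \<phi> \<longleftrightarrow> (\<forall>u v. u \<preceq> v \<longrightarrow> \<phi> u \<le> \<phi> v)"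

definition translation_invariance_axiom :: "(real ^ 'n \<Rightarrow> real) \<Rightarrow> bool" where
  "translation_invariance_axiom \<phi> \<longleftrightarrow> (\<forall>u \<alpha>. \<phi> (u + \<alpha> *\<^sub>R 1) = \<phi> u)"

definition positive_homogeneity_axiom :: "(real ^ 'n \<Rightarrow> real) \<Rightarrow> bool" where
  "positive_homogeneity_axiom \<phi> \<longleftrightarrow> (\<forall>u \<alpha>. \<alpha> > 0 \<longrightarrow> \<phi> (\<alpha> *\<^sub>R u) = \<alpha> * \<phi> u)"

(* A weight vector in R^N is a function on nat of which only the values at 1, ..., N matter,
   because the index type 'n carries no order. *)

definition weights :: "nat \<Rightarrow> (nat \<Rightarrow> real) set" where
  "weights N = {w. (\<Sum>i=1..N. w i) = 0 \<and> mono_on {1..N} w \<and> w 1 < 0 \<and> w N > 0}"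

definition order_based_measure :: "(nat \<Rightarrow> real) \<Rightarrow> real ^ 'n \<Rightarrow> real" where
  "order_based_measure w u = (\<Sum>i=1..CARD('n). w i * order_stat u i)"

end

theory Submission
  imports Defs
begin

text \<open>The \<open>i\<close>th order statistic is at most \<open>t\<close> exactly when at least \<open>i\<close> entries are at most \<open>t\<close>;
  this determines how order statistics behave under shifts, scaling and permutation, and
  makes them 1-Lipschitz. Summation by parts writes \<open>\<nu>\<^sub>w\<close> as a combination
  of tail sums with nonnegative coefficients \<open>w\<^sub>k - w\<^sub>k\<^sub>-\<^sub>1\<close>, plus a multiple of the total, which gives
  Schur convexity. Since the weights sum to zero, \<open>2 N \<nu>\<^sub>w(u)\<close> is the double sum of
  \<open>(w\<^sub>i - w\<^sub>j) (u\<^sub>(\<^sub>i\<^sub>) - u\<^sub>(\<^sub>j\<^sub>))\<close>, whose terms are nonnegative, and the term for \<open>(N, 1)\<close> vanishes only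
  if all entries agree.\<close>

section \<open>Order statistics\<close>

text \<open>In a sorted list the elements at most \<open>t\<close> form a prefix, whose length is
  that of the filtered list.\<close>

lemma sorted_nth_le_iff:
  fixes xs :: "'a::linorder list"
  assumes "sorted xs" "k < length xs"
  shows "xs ! k \<le> t \<longleftrightarrow> k < length (filter (\<lambda>x. x \<le> t) xs)"
  using assms
proof (induction xs arbitrary: k)
  case Nil
  then show ?case by simp
next
  case (Cons a xs)
  show ?case
  proof (cases "a \<le> t")
    case True
    with Cons show ?thesis by (cases k) auto
  next
    case False
    then have "\<forall>x\<in>set (a # xs). \<not> x \<le> t"
      using Cons.prems(1) by auto
    moreover from this have "filter (\<lambda>x. x \<le> t) (a # xs) = []"
      by (simp only: filter_empty_conv)
    ultimately show ?thesis
      using nth_mem[OF Cons.prems(2)] by auto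
  qed
qed

lemma order_stat_le_iff:
  fixes u :: "real ^ 'n"
  assumes "i \<in> {1..CARD('n)}"
  shows "order_stat u i \<le> t \<longleftrightarrow> i \<le> card {j. u $ j \<le> t}"
proof -
  define M where "M = image_mset (\<lambda>j. u $ j) (mset_set UNIV)"
  define xs where "xs = sorted_list_of_multiset M"
  have xs: "sorted xs" "mset xs = M"
    by (simp_all add: xs_def)
  then have len: "length xs = CARD('n)"
    by (simp flip: size_mset add: M_def)
  have "length (filter (\<lambda>x. x \<le> t) xs) = size (filter_mset (\<lambda>x. x \<le> t) M)"
    by (simp flip: size_mset xs(2))
  also have "\<dots> = card {j. u $ j \<le> t}"
    by (simp add: M_def filter_mset_image_mset)
  finally have "length (filter (\<lambda>x. x \<le> t) xs) = card {j. u $ j \<le> t}" .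
  moreover have "order_stat u i = xs ! (i - 1)"
    by (simp add: order_stat_def xs_def M_def)
  \<comment> \<open>Order statistics count from 1 and lists from 0; \<open>i \<ge> 1\<close> turns
    the strict bound into a weak one.\<close>
  moreover have "i - 1 < length xs" "i - 1 < c \<longleftrightarrow> i \<le> c" for c
    using assms by (auto simp: len)
  ultimately show ?thesis
    using sorted_nth_le_iff[OF xs(1)] by simp
qed

text \<open>Sorting only rearranges the entries. This turns the equal totals in
  \<open>\<preceq>\<close> into equal sums of order statistics.\<close>

lemma sum_order_stat:
  fixes u :: "real ^ 'n"
  shows "(\<Sum>i=1..CARD('n). order_stat u i) = (\<Sum>j\<in>UNIV. u $ j)"
proof -
  define M where "M = image_mset (\<lambda>j. u $ j) (mset_set UNIV)"
  define xs where "xs = sorted_list_of_multiset M"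
  have xs: "mset xs = M"
    by (simp add: xs_def)
  then have len: "length xs = CARD('n)"
    by (simp flip: size_mset add: M_def)
  have "(\<Sum>i=1..CARD('n). order_stat u i) = (\<Sum>i=1..CARD('n). xs ! (i - 1))"
    by (simp add: order_stat_def xs_def M_def)
  also have "\<dots> = (\<Sum>i<length xs. xs ! i)"
    by (rule sum.reindex_bij_witness[of _ Suc "\<lambda>i. i - 1"]) (auto simp: len)
  also have "\<dots> = sum_mset M"
    by (metis atLeast0LessThan sum_list_sum_nth sum_mset_sum_list xs)
  also have "\<dots> = (\<Sum>j\<in>UNIV. u $ j)"
    by (simp add: M_def sum_unfold_sum_mset)
  finally show ?thesis .
qed

lemma order_stat_mono_index:
  fixes u :: "real ^ 'n"
  assumes "i \<in> {1..CARD('n)}" "j \<in> {1..CARD('n)}" "i \<le> j"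
  shows "order_stat u i \<le> order_stat u j"
  using assms order_stat_le_iff[of j u "order_stat u j"]
  by (simp add: order_stat_le_iff)

lemma order_stat_first_le:
  fixes u :: "real ^ 'n"
  shows "order_stat u 1 \<le> u $ j"
proof -
  have "card {j} \<le> card {k. u $ k \<le> u $ j}"
    by (intro card_mono) auto
  then show ?thesis by (simp add: order_stat_le_iff)
qed

lemma order_stat_last_ge:
  fixes u :: "real ^ 'n"
  shows "u $ j \<le> order_stat u CARD('n)"
proof -
  have "CARD('n) \<le> card {k. u $ k \<le> order_stat u CARD('n)}"
    by (subst order_stat_le_iff[symmetric]) auto
  then have "{k. u $ k \<le> order_stat u CARD('n)} = UNIV"
    by (intro card_seteq) auto
  then show ?thesis by auto
qed

text \<open>Every entry of \<open>v\<close> below a threshold gives an entry of \<open>u\<close>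
  below the threshold raised by \<open>c\<close>, so the count cannot drop. Translation and the
  Lipschitz bound both rest on this.\<close>

lemma order_stat_le_add:
  fixes u v :: "real ^ 'n"
  assumes "i \<in> {1..CARD('n)}" "\<And>j. u $ j \<le> v $ j + c"
  shows "order_stat u i \<le> order_stat v i + c"
proof -
  have "i \<le> card {j. v $ j \<le> order_stat v i}"
    using assms(1) by (subst order_stat_le_iff[symmetric]) auto
  also have "\<dots> \<le> card {j. u $ j \<le> order_stat v i + c}"
    by (intro card_mono) (auto intro: order_trans[OF assms(2)])
  finally show ?thesis
    using assms(1) by (simp add: order_stat_le_iff)
qed

lemma order_stat_translate:
  fixes u :: "real ^ 'n"
  assumes "i \<in> {1..CARD('n)}"
  shows "order_stat (u + c *\<^sub>R 1) i = order_stat u i + c"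
  using order_stat_le_add[OF assms, of "u + c *\<^sub>R 1" u c]
    order_stat_le_add[OF assms, of u "u + c *\<^sub>R 1" "- c"]
  by simp

lemma order_stat_scaleR:
  fixes u :: "real ^ 'n"
  assumes "i \<in> {1..CARD('n)}" "c > 0"
  shows "order_stat (c *\<^sub>R u) i = c * order_stat u i"
proof -
  \<comment> \<open>Two reals with the same upper bounds are equal.\<close>
  have "order_stat (c *\<^sub>R u) i \<le> t \<longleftrightarrow> c * order_stat u i \<le> t" for t
    using assms order_stat_le_iff[OF assms(1), of u "t / c"]
    by (simp add: order_stat_le_iff pos_le_divide_eq mult.commute)
  then show ?thesis
    by (meson order.antisym order.refl)
qed

lemma continuous_on_order_stat:
  assumes "i \<in> {1..CARD('n)}"
  shows "continuous_on S (\<lambda>u :: real ^ 'n. order_stat u i)"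
proof -
  have le: "order_stat u i \<le> order_stat v i + dist u v" for u v :: "real ^ 'n"
  proof (rule order_stat_le_add[OF assms])
    fix j
    show "u $ j \<le> v $ j + dist u v"
      using component_le_norm_cart[of "u - v" j] by (simp add: dist_norm)
  qed
  have "1-lipschitz_on S (\<lambda>u :: real ^ 'n. order_stat u i)"
    using le by (intro lipschitz_onI) (smt (verit) dist_commute dist_real_def)+
  then show ?thesis
    by (rule lipschitz_on_continuous_on)
qed

lemma order_stat_permutation_matrix:
  fixes u :: "real ^ 'n"
  assumes "permutation_matrix P"
  shows "order_stat (P *v u) i = order_stat u i"
proof -
  have P01: "P $ k $ j = 0 \<or> P $ k $ j = 1" for k j
    using assms by (auto simp: permutation_matrix_def)
  \<comment> \<open>\<open>\<sigma> k\<close> is the column of the single 1 in row \<open>k\<close>;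
    the single 1 in each column makes \<open>\<sigma>\<close> bijective.\<close>
  obtain \<sigma> where \<sigma>: "\<And>k j. P $ k $ j = 1 \<longleftrightarrow> j = \<sigma> k"
    using assms unfolding permutation_matrix_def by metis
  have "\<forall>j. \<exists>!k. j = \<sigma> k"
    using assms unfolding permutation_matrix_def by (simp add: \<sigma>)
  then have "bij \<sigma>"
    unfolding bij_iff by metis
  have "P $ k $ j = (if j = \<sigma> k then 1 else 0)" for k j
    using P01[of k j] \<sigma>[of k j] by auto
  then have "(P *v u) $ k = u $ \<sigma> k" for k
    by (simp add: matrix_vector_mult_def if_distrib[of "\<lambda>x. x * _"] cong: if_cong)
  then have "image_mset (\<lambda>k. (P *v u) $ k) (mset_set UNIV) =
      image_mset (\<lambda>j. u $ j) (image_mset \<sigma> (mset_set UNIV))"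
    by (simp add: multiset.map_comp o_def)
  also have "image_mset \<sigma> (mset_set UNIV) = mset_set UNIV"
    using \<open>bij \<sigma>\<close> by (simp add: image_mset_mset_set bij_def)
  finally show ?thesis
    by (simp add: order_stat_def)
qed

section \<open>Two summation identities\<close>

text \<open>Abel summation: \<open>w i\<close> is \<open>w 1\<close> plus the increments up to
  \<open>i\<close>, and each increment \<open>w k - w (k - 1)\<close> is collected by all
  \<open>x i\<close> with \<open>i \<ge> k\<close>.\<close>

lemma sum_mult_by_parts:
  fixes w x :: "nat \<Rightarrow> 'a::comm_ring"
  assumes "n \<ge> 1"
  shows "(\<Sum>i=1..n. w i * x i) =
    w 1 * (\<Sum>i=1..n. x i) + (\<Sum>k=2..n. (w k - w (k - 1)) * (\<Sum>i=k..n. x i))"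
  using assms
proof (induction n rule: dec_induct)
  case base
  then show ?case by simp
next
  case (step n)
  have tele: "(\<Sum>k=2..Suc n. w k - w (k - 1)) = w (Suc n) - w 1"
    using step(1) by (induction n rule: dec_induct) (auto simp: numeral_2_eq_2)
  \<comment> \<open>Every tail gains \<open>x (Suc n)\<close>, with total coefficient given by
    \<open>tele\<close>; for \<open>k = Suc n\<close> the old tail is empty.\<close>
  have "(\<Sum>k=2..Suc n. (w k - w (k - 1)) * (\<Sum>i=k..Suc n. x i)) =
      (\<Sum>k=2..Suc n. (w k - w (k - 1)) * (\<Sum>i=k..n. x i) + (w k - w (k - 1)) * x (Suc n))"
    by (intro sum.cong) (auto simp: distrib_left)
  also have "\<dots> = (\<Sum>k=2..n. (w k - w (k - 1)) * (\<Sum>i=k..n. x i)) + (w (Suc n) - w 1) * x (Suc n)"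
    using step(1) by (simp only: sum.distrib flip: sum_distrib_right tele) simp
  finally show ?case
    using step by (simp add: algebra_simps)
qed

text \<open>The identity behind Chebyshev's sum inequality. The mixed products cancel because
  \<open>w\<close> sums to zero, and each of the two unmixed ones contributes \<open>card A\<close>
  copies of the sum.\<close>

lemma sum_sum_diff_mult_diff:
  fixes w x :: "'b \<Rightarrow> 'a::comm_ring_1"
  assumes "sum w A = 0"
  shows "(\<Sum>i\<in>A. \<Sum>j\<in>A. (w i - w j) * (x i - x j)) = 2 * of_nat (card A) * (\<Sum>i\<in>A. w i * x i)"
proof -
  have "(\<Sum>i\<in>A. \<Sum>j\<in>A. w i * x j) = 0" "(\<Sum>i\<in>A. \<Sum>j\<in>A. w j * x i) = 0"
    using assms by (simp_all flip: sum_distrib_left sum_distrib_right)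
  then show ?thesis
    by (simp add: algebra_simps sum.distrib sum_subtractf sum_distrib_left)
qed

section \<open>The axioms for the order-based measure\<close>

lemma order_based_measure_nonneg_eq_0:
  fixes u :: "real ^ 'n"
  assumes "w \<in> weights CARD('n)"
  shows "order_based_measure w u \<ge> 0"
    and "order_based_measure w u = 0 \<Longrightarrow> \<exists>\<alpha>. u = \<alpha> *\<^sub>R 1"
proof -
  let ?N = "CARD('n)"
  let ?s = "order_stat u"
  let ?D = "\<lambda>i j. (w i - w j) * (?s i - ?s j)"
  have w: "(\<Sum>i=1..?N. w i) = 0" "mono_on {1..?N} w" "w 1 < 0" "w ?N > 0"
    using assms by (auto simp: weights_def)
  \<comment> \<open>Weights and order statistics are both nondecreasing, so the two factors never
    have opposite signs.\<close>
  have D: "?D i j \<ge> 0" if "i \<in> {1..?N}" "j \<in> {1..?N}" for i j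
  proof (cases "i \<le> j")
    case True
    with that w(2) show ?thesis
      by (intro mult_nonpos_nonpos) (auto intro: mono_onD order_stat_mono_index)
  next
    case False
    with that w(2) show ?thesis
      by (intro mult_nonneg_nonneg) (auto intro: mono_onD order_stat_mono_index)
  qed
  have eq: "(\<Sum>i=1..?N. \<Sum>j=1..?N. ?D i j) = 2 * real ?N * order_based_measure w u"
    using sum_sum_diff_mult_diff[OF w(1), of ?s] by (simp add: order_based_measure_def)
  have "0 \<le> (\<Sum>i=1..?N. \<Sum>j=1..?N. ?D i j)"
    using D by (intro sum_nonneg) auto
  then show "order_based_measure w u \<ge> 0"
    unfolding eq by (simp add: zero_le_mult_iff)
  assume "order_based_measure w u = 0"
  then have "(\<Sum>i=1..?N. \<Sum>j=1..?N. ?D i j) = 0"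
    unfolding eq by simp
  then have "\<forall>i\<in>{1..?N}. (\<Sum>j=1..?N. ?D i j) = 0"
    using D by (subst (asm) sum_nonneg_eq_0_iff) (auto intro!: sum_nonneg)
  then have "(\<Sum>j=1..?N. ?D ?N j) = 0"
    by (simp add: Suc_leI)
  then have "\<forall>j\<in>{1..?N}. ?D ?N j = 0"
    using D by (subst (asm) sum_nonneg_eq_0_iff) (auto simp: Suc_leI)
  then have "?D ?N 1 = 0"
    by (simp add: Suc_leI)
  \<comment> \<open>The factor \<open>w ?N - w 1\<close> is positive and cancels; every entry then
    lies between two equal extremes.\<close>
  then have "?s 1 = ?s ?N"
    using w(3,4) by auto
  then have "u $ j = ?s 1" for j
    using order_stat_first_le[of u j] order_stat_last_ge[of u j] by simp
  then have "u = ?s 1 *\<^sub>R 1"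
    by (simp add: vec_eq_iff)
  then show "\<exists>\<alpha>. u = \<alpha> *\<^sub>R 1" ..
qed

lemma order_based_measure_translate:
  fixes u :: "real ^ 'n"
  assumes "(\<Sum>i=1..CARD('n). w i) = 0"
  shows "order_based_measure w (u + c *\<^sub>R 1) = order_based_measure w u"
proof -
  have "order_based_measure w (u + c *\<^sub>R 1) =
      (\<Sum>i=1..CARD('n). w i * order_stat u i + w i * c)"
    unfolding order_based_measure_def
    by (intro sum.cong) (auto simp: order_stat_translate distrib_left)
  also have "\<dots> = order_based_measure w u + (\<Sum>i=1..CARD('n). w i) * c"
    by (simp add: order_based_measure_def sum.distrib sum_distrib_right)
  finally show ?thesis
    using assms by simp
qed

lemma order_based_measure_scaleR:
  fixes u :: "real ^ 'n"
  assumes "c > 0"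
  shows "order_based_measure w (c *\<^sub>R u) = c * order_based_measure w u"
  using assms by (simp add: order_based_measure_def order_stat_scaleR sum_distrib_left algebra_simps)

lemma order_based_measure_mono_majorized:
  fixes u v :: "real ^ 'n"
  assumes "mono_on {1..CARD('n)} w" "u \<preceq> v"
  shows "order_based_measure w u \<le> order_based_measure w v"
proof -
  let ?N = "CARD('n)"
  have "(w k - w (k - 1)) * (\<Sum>i=k..?N. order_stat u i)
      \<le> (w k - w (k - 1)) * (\<Sum>i=k..?N. order_stat v i)" if "k \<in> {2..?N}" for k
  proof (rule mult_left_mono)
    show "(\<Sum>i=k..?N. order_stat u i) \<le> (\<Sum>i=k..?N. order_stat v i)"
      using assms(2) that unfolding majorized_by_def by blast
    \<comment> \<open>\<open>k \<ge> 2\<close> keeps \<open>k - 1\<close> in the index range on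
      which \<open>w\<close> is monotone.\<close>
    show "0 \<le> w k - w (k - 1)"
      using mono_onD[OF assms(1), of "k - 1" k] that by force
  qed
  then have "(\<Sum>k=2..?N. (w k - w (k - 1)) * (\<Sum>i=k..?N. order_stat u i))
      \<le> (\<Sum>k=2..?N. (w k - w (k - 1)) * (\<Sum>i=k..?N. order_stat v i))"
    by (rule sum_mono)
  \<comment> \<open>The remaining terms, \<open>w 1\<close> times the total, agree because
    majorization includes equal totals.\<close>
  then show ?thesis
    using assms(2) sum_mult_by_parts[of ?N w "order_stat u"] sum_mult_by_parts[of ?N w "order_stat v"]
    unfolding order_based_measure_def majorized_by_def sum_order_stat
    by (simp add: Suc_leI)
qed

theorem proposition1:
  fixes w :: "nat \<Rightarrow> real"
    and \<nu> :: "real ^ 'n \<Rightarrow> real"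
  assumes "w \<in> weights CARD('n)"
    and "\<nu> = order_based_measure w"
  shows "continuity_axiom \<nu> \<and> normalization_axiom \<nu> \<and> symmetry_axiom \<nu> \<and> schur_convexity_axiom \<nu> \<and>
    translation_invariance_axiom \<nu> \<and> positive_homogeneity_axiom \<nu>"
proof (intro conjI)
  have w: "(\<Sum>i=1..CARD('n). w i) = 0" "mono_on {1..CARD('n)} w"
    using assms(1) by (auto simp: weights_def)
  show "continuity_axiom \<nu>"
    unfolding continuity_axiom_def assms(2) order_based_measure_def
    by (intro continuous_intros continuous_on_order_stat)
  \<comment> \<open>A constant vector is a translate of 0, and scaling 0 by 2 gives
    \<open>\<nu> 0 = 2 * \<nu> 0\<close>.\<close>
  have "\<nu> (\<alpha> *\<^sub>R 1) = 0" for \<alpha>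
  proof -
    have "\<nu> (\<alpha> *\<^sub>R 1) = \<nu> 0"
      using order_based_measure_translate[OF w(1), of 0 \<alpha>] by (simp add: assms(2))
    also have "\<dots> = 0"
      using order_based_measure_scaleR[of 2 w "0 :: real ^ 'n"] by (simp add: assms(2))
    finally show ?thesis .
  qed
  then show "normalization_axiom \<nu>"
    using order_based_measure_nonneg_eq_0[OF assms(1)]
    unfolding normalization_axiom_def assms(2) by blast
  show "symmetry_axiom \<nu>"
    by (simp add: symmetry_axiom_def assms(2) order_based_measure_def order_stat_permutation_matrix)
  show "schur_convexity_axiom \<nu>"
    using order_based_measure_mono_majorized[OF w(2)]
    by (auto simp: schur_convexity_axiom_def assms(2))
  show "translation_invariance_axiom \<nu>"
    using order_based_measure_translate[OF w(1)]
    by (auto simp: translation_invariance_axiom_def assms(2))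
  show "positive_homogeneity_axiom \<nu>"
    by (simp add: positive_homogeneity_axiom_def assms(2) order_based_measure_scaleR)
qed

end
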